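(* For every nonempty bounded $H\subset\mathbb{R}$, $LAvg(H)=LAvg(cl(H))$ (one side exists if and only if the other does); i.e. $LAvg$ is closed.
   Context: For $H\subset\mathbb{R}$, $\delta>0$: $S(H,\delta)=\{y\in\mathbb{R}:\exists x\in H,\ |x-y|<\delta\}$. $\lambda$ is Lebesgue measure; for bounded measurable $K$ with $\lambda(K)>0$, $Avg(K)=\frac{\int_K x\,d\lambda}{\lambda(K)}$. $LAvg(H)=\lim_{\delta\to 0+0}Avg(S(H,\delta))$ if the limit exists. $cl(H)$ is the closure of $H$. A function $\mathcal{K}$ on some bounded subsets of $\mathbb{R}$ is closed if $H,cl(H)\in Dom(\mathcal{K})$ implies $\mathcal{K}(cl(H))=\mathcal{K}(H)$. *)

theory Defs
  imports "HOL-Analysis.Analysis"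
begin

definition nbhd :: "real set \<Rightarrow> real \<Rightarrow> real set" where
  "nbhd H \<delta> = {y. \<exists>x\<in>H. \<bar>x - y\<bar> < \<delta>}"

(* Meaningful only for bounded measurable K of positive Lebesgue measure; LAvg below
   applies it only to such sets (bounded nonempty open ones). *)
definition Avg :: "real set \<Rightarrow> real" where
  "Avg K = (LINT x:K|lebesgue. x) / measure lebesgue K"

(* A mean defined on some sets of reals is a partial function; None means "undefined".
   LAvg is undefined on unbounded sets and on the empty set, where Avg (nbhd H \<delta>)
   is undefined. *)
definition LAvg :: "real set \<rightharpoonup> real" where
  "LAvg H =
     (if bounded H \<and> H \<noteq> {} \<and> (\<exists>l. ((\<lambda>\<delta>. Avg (nbhd H \<delta>)) \<longlongrightarrow> l) (at_right 0))
      then Some (Lim (at_right 0) (\<lambda>\<delta>. Avg (nbhd H \<delta>))) else None)"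

definition closed_mean :: "(real set \<rightharpoonup> real) \<Rightarrow> bool" where
  "closed_mean K \<longleftrightarrow> (\<forall>H. H \<in> dom K \<and> closure H \<in> dom K \<longrightarrow> K (closure H) = K H)"

end

theory Submission
  imports Defs
begin

text \<open>\<open>LAvg\<close> sees a set only through its open \<delta>-neighbourhoods, and these
  do not change under closure (\<open>nbhd_closure\<close>). So the averages for \<open>H\<close>
  and \<open>closure H\<close> coincide for each \<delta>, not merely in the limit.\<close>

lemma nbhd_closure: "nbhd (closure H) \<delta> = nbhd H \<delta>"
proof
  show "nbhd (closure H) \<delta> \<subseteq> nbhd H \<delta>"
  proof
    fix y assume "y \<in> nbhd (closure H) \<delta>"
    then obtain x where x: "x \<in> closure H" "\<bar>x - y\<bar> < \<delta>"
      by (auto simp: nbhd_def)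
    \<comment> \<open>The strict inequality in \<open>nbhd\<close> leaves positive slack, which
      absorbs the move from \<open>x\<close> to a nearby point of \<open>H\<close>.\<close>
    then obtain x' where "x' \<in> H" "dist x' x < \<delta> - \<bar>x - y\<bar>"
      using closure_approachable[of x H] by (meson diff_gt_0_iff_gt)
    then have "\<bar>x' - y\<bar> < \<delta>"
      by (auto simp: dist_real_def)
    with \<open>x' \<in> H\<close> show "y \<in> nbhd H \<delta>"
      by (auto simp: nbhd_def)
  qed
  show "nbhd H \<delta> \<subseteq> nbhd (closure H) \<delta>"
    using closure_subset by (auto simp: nbhd_def)
qed

text \<open>As an equation of option values this also settles existence: \<open>None\<close> on one
  side forces \<open>None\<close> on the other. Hence the guards of \<open>LAvg\<close>, boundedness
  and nonemptiness, must be closure-invariant too.\<close>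

lemma LAvg_closure: "LAvg (closure H) = LAvg H"
proof -
  have "bounded (closure H) \<longleftrightarrow> bounded H"
    using bounded_closure bounded_subset closure_subset by blast
  then show ?thesis
    by (simp add: LAvg_def nbhd_closure)
qed

theorem proposition5p2:
  shows "(\<forall>H :: real set. bounded H \<and> H \<noteq> {} \<longrightarrow>
            (H \<in> dom LAvg \<longleftrightarrow> closure H \<in> dom LAvg) \<and> LAvg H = LAvg (closure H))
         \<and> closed_mean LAvg"
  by (simp add: closed_mean_def LAvg_closure domIff)

end
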